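(* Let $(G,\lambda)$ be a finite complete edge-colored graph, and assume that $\lambda$ takes at least two different values on pairs of distinct vertices. Then $(G,\lambda)$ is representable in $\mathbb{R}^{|G|-2}$, where $|G|$ denotes the number of vertices of $G$.
   Context: A complete edge-colored graph $(G,\lambda)$ is a finite set $G$ (its vertices) together with a map $\lambda: G^2\to\mathbb{R}$ such that $\lambda(x,x)=0$ and $\lambda(y,x)=\lambda(x,y)$ for all $x,y\in G$. It is called representable in $\mathbb{R}^n$ if there is a map $f: G\to\mathbb{R}^n$ such that for all $x\neq x'$ and $y\neq y'$ in $G$, $\|f(x)-f(x')\| = \|f(y)-f(y')\|$ if and only if $\lambda(x,x')=\lambda(y,y')$, where $\|\cdot\|$ is the Euclidean norm. *)

theory Defs
  imports "HOL-Analysis.Analysis"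
begin

definition complete_edge_colored_graph :: "'a set \<Rightarrow> ('a \<Rightarrow> 'a \<Rightarrow> real) \<Rightarrow> bool" where
  "complete_edge_colored_graph G lam \<longleftrightarrow>
     finite G \<and> (\<forall>x\<in>G. lam x x = 0) \<and> (\<forall>x\<in>G. \<forall>y\<in>G. lam y x = lam x y)"

(* The ambient space is real ^ 'n, so the dimension CARD('n) is passed as a type.
   The map f is not required to be injective. *)
definition representable_in ::
    "'n::finite itself \<Rightarrow> 'a set \<Rightarrow> ('a \<Rightarrow> 'a \<Rightarrow> real) \<Rightarrow> bool" where
  "representable_in (_ :: 'n itself) G lam \<longleftrightarrow>
     (\<exists>f :: 'a \<Rightarrow> real ^ 'n. \<forall>x\<in>G. \<forall>x'\<in>G. \<forall>y\<in>G. \<forall>y'\<in>G. x \<noteq> x' \<longrightarrow> y \<noteq> y' \<longrightarrow>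
        (norm (f x - f x') = norm (f y - f y') \<longleftrightarrow> lam x x' = lam y y'))"

end

theory Submission
  imports Defs
begin

text \<open>
  Let \<open>\<mu>\<close> be the maximum of the quadratic form of \<open>lam\<close> on the unit vectors with coordinate sum \<open>0\<close>,
  and put \<open>D i j = \<mu> + lam i j\<close> off the diagonal. On vectors with coordinate sum \<open>0\<close> the form of
  \<open>D\<close> is that of \<open>lam\<close> minus \<open>\<mu>\<close> times the squared norm, so it is nonpositive, and it vanishes at
  the maximiser. By Schoenberg's criterion the \<open>D i j\<close> are (up to a constant factor) squared Euclidean
  distances, and the null vector lowers the dimension from \<open>card G - 1\<close> to \<open>card G - 2\<close>.
  Distances then agree exactly when the colours do, whatever the sign of \<open>\<mu>\<close>.
\<close>

section \<open>Quadratic forms over a finite index set\<close>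

definition qform :: "'i set \<Rightarrow> ('i \<Rightarrow> 'i \<Rightarrow> real) \<Rightarrow> ('i \<Rightarrow> real) \<Rightarrow> real" where
  "qform A g x = (\<Sum>i\<in>A. \<Sum>j\<in>A. g i j * x i * x j)"

text \<open>Symmetry is demanded separately, since a quadratic form determines only the symmetric
  part of \<open>g\<close>.\<close>

definition psd_on :: "'i set \<Rightarrow> ('i \<Rightarrow> 'i \<Rightarrow> real) \<Rightarrow> bool" where
  "psd_on A g \<longleftrightarrow> (\<forall>i\<in>A. \<forall>j\<in>A. g i j = g j i) \<and> (\<forall>x. 0 \<le> qform A g x)"

lemma qform_cong:
  assumes "\<And>i. i \<in> A \<Longrightarrow> x i = y i"
  shows "qform A g x = qform A g y"
  using assms by (simp add: qform_def)

lemma qform_scale: "qform A g (\<lambda>i. c * x i) = c\<^sup>2 * qform A g x"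
  by (simp add: qform_def sum_distrib_left power2_eq_square mult_ac)

lemma qform_insert:
  assumes "finite B" "a \<notin> B" "\<forall>j\<in>B. g j a = g a j"
  shows "qform (insert a B) g x = qform B g x + 2 * x a * (\<Sum>j\<in>B. g a j * x j) + g a a * (x a)\<^sup>2"
proof -
  have "(\<Sum>i\<in>B. g i a * x i * x a) = x a * (\<Sum>j\<in>B. g a j * x j)"
    using assms(3) by (simp add: sum_distrib_left mult_ac)
  moreover have "(\<Sum>j\<in>B. g a j * x a * x j) = x a * (\<Sum>j\<in>B. g a j * x j)"
    by (simp add: sum_distrib_left mult_ac)
  ultimately show ?thesis
    using assms(1,2) by (simp add: qform_def sum.distrib power2_eq_square)
qed

text \<open>A null vector minimises a semidefinite form, so the derivative there vanishes in every
  coordinate direction; by symmetry of \<open>g\<close> that derivative is twice the row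
  sum.\<close>

lemma psd_null_vector:
  assumes "finite A" "psd_on A g" "qform A g v = 0" "i \<in> A"
  shows "(\<Sum>j\<in>A. g i j * v j) = 0"
proof -
  define B where "B = A - {i}"
  have A: "A = insert i B" "i \<notin> B" "finite B" using assms by (auto simp: B_def)
  have sym: "\<forall>j\<in>B. g j i = g i j"
    using assms by (auto simp: psd_on_def B_def)
  define r where "r = (\<Sum>j\<in>A. g i j * v j)"
  have r: "r = g i i * v i + (\<Sum>j\<in>B. g i j * v j)"
    unfolding r_def A(1) using A(2,3) by simp
  have pos: "0 \<le> 2 * t * r + g i i * t\<^sup>2" for t
  proof -
    define w where "w = v(i := v i + t)"
    have "qform B g w = qform B g v"
      using A(2) by (intro qform_cong) (auto simp: w_def)
    moreover have "(\<Sum>j\<in>B. g i j * w j) = (\<Sum>j\<in>B. g i j * v j)"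
      using A(2) by (intro sum.cong) (auto simp: w_def)
    ultimately have "qform A g w = qform A g v + 2 * t * r + g i i * t\<^sup>2"
      unfolding A(1) qform_insert[where g = g, OF A(3,2) sym] r
      by (simp add: w_def power2_eq_square algebra_simps)
    then show ?thesis using assms(2,3) by (metis psd_on_def add_0)
  qed
  have "r = 0"
  proof (cases "g i i = 0")
    case True
    then have "r\<^sup>2 \<le> 0" using pos[of "- r"] by (simp add: power2_eq_square)
    then show ?thesis by simp
  next
    case False
    moreover have "0 \<le> g i i" using pos[of 1] pos[of "- 1"] by simp
    ultimately have g: "g i i > 0" by simp
    \<comment> \<open>The shift \<open>- r / g i i\<close> is the vertex of the parabola in
      \<open>pos\<close>.\<close>
    have "0 \<le> - (r\<^sup>2 / g i i)"
      using pos[of "- r / g i i"] g by (simp add: power2_eq_square field_simps)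
    with g show ?thesis by (simp add: field_simps)
  qed
  then show ?thesis by (simp add: r_def)
qed

section \<open>Gram factorizations of semidefinite matrices\<close>

text \<open>Cholesky elimination: removing the rank-one part carried by the pivot \<open>a\<close>
  leaves a semidefinite Schur complement on \<open>B\<close>, to which the induction applies. Each
  pivot contributes one coordinate, so \<open>A\<close> itself indexes the coordinates.\<close>

lemma psd_factorization:
  assumes "finite A" "psd_on A g"
  shows "\<exists>f :: 'i \<Rightarrow> 'i \<Rightarrow> real. \<forall>i\<in>A. \<forall>j\<in>A. g i j = (\<Sum>c\<in>A. f i c * f j c)"
  using assms
proof (induction A arbitrary: g rule: finite_induct)
  case empty
  then show ?case by simp
next
  case (insert a B)
  have sym: "g i j = g j i" if "i \<in> insert a B" "j \<in> insert a B" for i j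
    using insert.prems that by (auto simp: psd_on_def)
  have sym_a: "\<forall>j\<in>B. g j a = g a j" using sym by simp
  note ins = qform_insert[where g = g, OF insert.hyps sym_a]
  have gaa: "0 \<le> g a a"
  proof -
    have "qform (insert a B) g (\<lambda>i. if i = a then 1 else 0) = g a a"
    proof -
      have "qform B g (\<lambda>i. if i = a then 1 else 0) = qform B g (\<lambda>i. 0 * 0)"
        using insert.hyps by (intro qform_cong) auto
      then show ?thesis
        using insert.hyps(2) ins[of "\<lambda>i. if i = a then 1 else 0"]
        by (auto simp: qform_def intro!: sum.neutral)
    qed
    then show ?thesis using insert.prems by (metis psd_on_def)
  qed
  \<comment> \<open>A zero pivot makes the unit vector at \<open>a\<close> a null vector, which
    forces the whole row of \<open>a\<close> to vanish.\<close>
  have gaj: "g a j = 0" if "g a a = 0" "j \<in> insert a B" for j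
  proof -
    let ?e = "\<lambda>i. if i = a then 1 else (0::real)"
    have "qform B g ?e = 0" "(\<Sum>j\<in>B. g a j * ?e j) = 0"
      using insert.hyps(2) by (auto simp: qform_def intro!: sum.neutral)
    then have "qform (insert a B) g ?e = 0" using that(1) ins[of ?e] by simp
    from psd_null_vector[OF _ insert.prems this that(2)] insert.hyps
    have "g j a + (\<Sum>i\<in>B. g j i * ?e i) = 0" by simp
    moreover have "(\<Sum>i\<in>B. g j i * ?e i) = 0"
      using insert.hyps(2) by (auto intro!: sum.neutral)
    ultimately show ?thesis using sym[of a j] that by simp
  qed
  \<comment> \<open>The Schur complement of the pivot. If \<open>g a a = 0\<close>, division by zero
    gives 0 and \<open>h\<close> is \<open>g\<close>.\<close>
  define h where "h i j = g i j - g a i * g a j / g a a" for i j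
  have "psd_on B h"
    unfolding psd_on_def
  proof (intro conjI ballI allI)
    fix i j assume "i \<in> B" "j \<in> B"
    then show "h i j = h j i" using sym[of i j] by (simp add: h_def)
  next
    fix x
    define r where "r = (\<Sum>j\<in>B. g a j * x j)"
    \<comment> \<open>For a positive pivot this value at \<open>a\<close> minimises the form in that
      coordinate, and completing the square leaves the form of \<open>h\<close>. For a zero pivot
      the value is 0.\<close>
    define y where "y = x(a := - r / g a a)"
    have "qform B g y = qform B g x"
      using insert.hyps(2) by (intro qform_cong) (auto simp: y_def)
    moreover have "(\<Sum>j\<in>B. g a j * y j) = r"
      unfolding r_def using insert.hyps(2) by (intro sum.cong) (auto simp: y_def)
    ultimately have "qform (insert a B) g y = qform B g x - r\<^sup>2 / g a a"
      using ins[of y] by (cases "g a a = 0") (simp_all add: y_def power2_eq_square field_simps)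
    also have "r\<^sup>2 / g a a = (\<Sum>i\<in>B. \<Sum>j\<in>B. g a i * g a j / g a a * x i * x j)"
      by (simp add: r_def power2_eq_square sum_product sum_divide_distrib mult_ac)
    also have "qform B g x - \<dots> = qform B h x"
      by (simp add: qform_def h_def left_diff_distrib sum_subtractf)
    finally show "0 \<le> qform B h x" using insert.prems by (metis psd_on_def)
  qed
  then obtain f where f: "\<And>i j. i \<in> B \<Longrightarrow> j \<in> B \<Longrightarrow> h i j = (\<Sum>c\<in>B. f i c * f j c)"
    using insert.IH by blast
  \<comment> \<open>Column \<open>a\<close> restores the rank-one part removed in \<open>h\<close>;
    it is 0 for a zero pivot, since division by \<open>sqrt 0\<close> gives 0.\<close>
  define F where "F i c = (if c = a then g a i / sqrt (g a a) else if i = a then 0 else f i c)" for i c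
  have "g i j = (\<Sum>c\<in>insert a B. F i c * F j c)" if ij: "i \<in> insert a B" "j \<in> insert a B" for i j
  proof -
    have "(\<Sum>c\<in>insert a B. F i c * F j c) = g a i * g a j / g a a + (\<Sum>c\<in>B. F i c * F j c)"
      using insert.hyps gaa by (simp add: F_def)
    also have "(\<Sum>c\<in>B. F i c * F j c) = (if i = a \<or> j = a then 0 else h i j)"
    proof (cases "i = a \<or> j = a")
      case True
      then show ?thesis using insert.hyps(2) by (auto simp: F_def intro!: sum.neutral)
    next
      case False
      then have "(\<Sum>c\<in>B. F i c * F j c) = (\<Sum>c\<in>B. f i c * f j c)"
        using insert.hyps(2) by (intro sum.cong) (auto simp: F_def)
      then show ?thesis using False f ij by simp
    qed
    finally show ?thesis
      using ij gaj sym[of i a] sym[of a a] by (cases "g a a = 0") (auto simp: h_def)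
  qed
  then show ?case by blast
qed

text \<open>The null vector writes column \<open>k\<close> as a linear combination of the other
  columns. Gram vectors for the indices other than \<open>k\<close> therefore extend to
  \<open>k\<close> by the same combination, without a new coordinate.\<close>

lemma psd_singular_factorization:
  assumes "finite A" "psd_on A g" "qform A g v = 0" "k \<in> A" "v k \<noteq> 0"
  shows "\<exists>f :: 'i \<Rightarrow> 'i \<Rightarrow> real. \<forall>i\<in>A. \<forall>j\<in>A. g i j = (\<Sum>c\<in>A - {k}. f i c * f j c)"
proof -
  define B where "B = A - {k}"
  have A: "A = insert k B" "k \<notin> B" "finite B" using assms by (auto simp: B_def)
  have sym: "g i j = g j i" if "i \<in> A" "j \<in> A" for i j
    using assms that by (auto simp: psd_on_def)
  have sym_k: "\<forall>j\<in>B. g j k = g k j" using sym A(1) by simp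
  have "psd_on B g"
    unfolding psd_on_def
  proof (intro conjI ballI allI)
    fix x
    have "qform B g (x(k := 0)) = qform B g x"
      using A(2) by (intro qform_cong) auto
    then have "qform B g x = qform A g (x(k := 0))"
      unfolding A(1) qform_insert[where g = g, OF A(3,2) sym_k] by simp
    then show "0 \<le> qform B g x" using assms(2) by (simp add: psd_on_def)
  qed (use sym A(1) in auto)
  then obtain f where f: "\<And>i j. i \<in> B \<Longrightarrow> j \<in> B \<Longrightarrow> g i j = (\<Sum>c\<in>B. f i c * f j c)"
    using psd_factorization[OF A(3)] by blast
  have ker: "g i k = (\<Sum>l\<in>B. - v l / v k * g i l)" if "i \<in> A" for i
  proof -
    have "g i k * v k + (\<Sum>l\<in>B. g i l * v l) = 0"
      using psd_null_vector[OF assms(1-3) that] A by simp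
    then have "g i k = - (\<Sum>l\<in>B. g i l * v l) / v k"
      using assms(5) by (simp add: field_simps)
    then show ?thesis by (simp add: sum_divide_distrib sum_negf mult_ac)
  qed
  define F where "F i c = (if i = k then \<Sum>l\<in>B. - v l / v k * f l c else f i c)" for i c
  have Fk: "(\<Sum>c\<in>B. u c * F k c) = (\<Sum>l\<in>B. - v l / v k * (\<Sum>c\<in>B. u c * f l c))" for u
    unfolding F_def by (simp add: sum_distrib_left mult_ac sum_negf) (rule sum.swap)
  have FB: "F i = f i" if "i \<in> B" for i using that A(2) by (auto simp: F_def)
  have FBk: "g i k = (\<Sum>c\<in>B. F i c * F k c)" if "i \<in> B" for i
    using that f ker[of i] A(1) by (simp add: FB Fk)
  \<comment> \<open>Expanding one factor reduces the corner entry to the mixed entries from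
    \<open>FBk\<close>; then \<open>ker\<close> applies to row \<open>k\<close>.\<close>
  have Fkk: "g k k = (\<Sum>c\<in>B. F k c * F k c)"
  proof -
    have "(\<Sum>c\<in>B. F k c * F k c) = (\<Sum>l\<in>B. - v l / v k * (\<Sum>c\<in>B. F k c * f l c))"
      by (rule Fk)
    also have "\<dots> = (\<Sum>l\<in>B. - v l / v k * g k l)"
      using FBk sym_k by (intro sum.cong) (auto simp: FB mult.commute)
    finally show ?thesis using ker[of k] A(1) by simp
  qed
  have "g i j = (\<Sum>c\<in>B. F i c * F j c)" if ij: "i \<in> A" "j \<in> A" for i j
  proof -
    consider "i \<in> B" "j \<in> B" | "i \<in> B" "j = k" | "i = k" "j \<in> B" | "i = k" "j = k"
      using ij A(1) by auto
    then show ?thesis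
      using f FBk Fkk sym_k by cases (auto simp: FB mult.commute)
  qed
  then show ?thesis unfolding B_def by blast
qed

section \<open>Maximising a quadratic form on sum-zero unit vectors\<close>

text \<open>Compactness of the unit sphere in the sum-zero hyperplane yields a maximiser;
  homogeneity of degree two carries the bound to all sum-zero vectors.\<close>

lemma max_qform_sum_zero:
  assumes "finite G" "a \<in> G" "b \<in> G" "a \<noteq> b"
  obtains u where "sum u G = 0" "(\<Sum>i\<in>G. (u i)\<^sup>2) = 1"
    "\<And>x. sum x G = 0 \<Longrightarrow> qform G g x \<le> qform G g u * (\<Sum>i\<in>G. (x i)\<^sup>2)"
proof -
  \<comment> \<open>Pinning the coordinates outside \<open>G\<close> to 0 keeps this box compact by
    Tychonoff, even for infinite \<open>'a\<close>.\<close>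
  define P :: "('a \<Rightarrow> real) set" where "P = (\<Pi>\<^sub>E i\<in>UNIV. if i \<in> G then {-1..1} else {0})"
  define K where "K = P \<inter> {x. sum x G = 0} \<inter> {x. (\<Sum>i\<in>G. (x i)\<^sup>2) = 1}"
  have "compactin (product_topology (\<lambda>i::'a. euclidean :: real topology) UNIV) P"
    unfolding P_def by (subst compactin_PiE) auto
  then have "compact P"
    by (simp add: euclidean_product_topology)
  moreover have "closed {x::'a \<Rightarrow> real. sum x G = 0}" "closed {x::'a \<Rightarrow> real. (\<Sum>i\<in>G. (x i)\<^sup>2) = 1}"
    by (intro closed_Collect_eq continuous_intros continuous_on_product_coordinates)+
  ultimately have "compact K"
    unfolding K_def by (intro compact_Int_closed)
  have inK: "(\<lambda>i. if i \<in> G then x i else 0) \<in> K" if "sum x G = 0" "(\<Sum>i\<in>G. (x i)\<^sup>2) = 1" for x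
  proof -
    have "\<bar>x i\<bar> \<le> 1" if "i \<in> G" for i
    proof -
      have "(x i)\<^sup>2 \<le> 1"
        using \<open>(\<Sum>i\<in>G. (x i)\<^sup>2) = 1\<close> member_le_sum[of i G "\<lambda>i. (x i)\<^sup>2"] that assms(1) by simp
      then show ?thesis by (simp add: abs_square_le_1)
    qed
    then show ?thesis using that by (auto simp: K_def P_def abs_le_iff minus_le_iff)
  qed
  have scale: "\<exists>y\<in>K. qform G g x = qform G g y * (\<Sum>i\<in>G. (x i)\<^sup>2)"
    if "sum x G = 0" "(\<Sum>i\<in>G. (x i)\<^sup>2) \<noteq> 0" for x
  proof -
    define s where "s = (\<Sum>i\<in>G. (x i)\<^sup>2)"
    have s: "s > 0" using that(2) sum_nonneg[of G "\<lambda>i. (x i)\<^sup>2"] by (simp add: s_def)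
    define y where "y i = (1 / sqrt s) * x i" for i
    have "sum y G = 0" by (simp add: y_def that(1) flip: sum_distrib_left sum_divide_distrib)
    moreover have "(\<Sum>i\<in>G. (y i)\<^sup>2) = 1"
      using s by (simp add: y_def power_divide s_def[symmetric] flip: sum_divide_distrib)
    ultimately have "(\<lambda>i. if i \<in> G then y i else 0) \<in> K" by (rule inK)
    moreover have "qform G g (\<lambda>i. if i \<in> G then y i else 0) = qform G g y"
      by (rule qform_cong) simp
    moreover have "qform G g y = qform G g x / s"
      unfolding y_def qform_scale using s by (simp add: power_divide)
    ultimately show ?thesis using s by (auto simp: s_def intro!: bexI)
  qed
  have "K \<noteq> {}"
  proof -
    \<comment> \<open>A difference of two unit vectors is a nonzero sum-zero vector; rescaled, it
      lies in \<open>K\<close>.\<close>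
    define e :: "'a \<Rightarrow> real" where "e i = (if i = a then 1 else 0) - (if i = b then 1 else 0)" for i
    have "sum e G = 0" using assms by (simp add: e_def sum_subtractf)
    moreover have "(\<Sum>i\<in>G. (e i)\<^sup>2) \<noteq> 0"
      using assms by (subst sum_nonneg_eq_0_iff) (auto simp: e_def)
    ultimately show ?thesis using scale by blast
  qed
  moreover have "continuous_on K (qform G g)"
    unfolding qform_def
    by (intro continuous_intros continuous_on_subset[OF continuous_on_product_coordinates]) auto
  ultimately obtain u where u: "u \<in> K" "\<And>y. y \<in> K \<Longrightarrow> qform G g y \<le> qform G g u"
    using continuous_attains_sup[OF \<open>compact K\<close>] by blast
  show thesis
  proof (rule that)
    show "sum u G = 0" "(\<Sum>i\<in>G. (u i)\<^sup>2) = 1" using u(1) by (auto simp: K_def)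
  next
    fix x :: "'a \<Rightarrow> real" assume x: "sum x G = 0"
    show "qform G g x \<le> qform G g u * (\<Sum>i\<in>G. (x i)\<^sup>2)"
    proof (cases "(\<Sum>i\<in>G. (x i)\<^sup>2) = 0")
      case True
      then have "\<And>i. i \<in> G \<Longrightarrow> x i = 0" using assms(1) by (simp add: sum_nonneg_eq_0_iff)
      then show ?thesis using True by (simp add: qform_def)
    next
      case False
      with scale x obtain y where "y \<in> K" "qform G g x = qform G g y * (\<Sum>i\<in>G. (x i)\<^sup>2)"
        by blast
      then show ?thesis using u(2) by (simp add: mult_right_mono sum_nonneg)
    qed
  qed
qed

section \<open>Schoenberg embedding with one dimension saved\<close>

text \<open>For squared distances \<open>D\<close>, the inner products relative to the base point
  \<open>p\<close> are half of \<open>D i p + D j p - D i j\<close>. Gram vectors for this matrix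
  thus realise \<open>2 * D\<close>, and the null vector \<open>u\<close> removes coordinate
  \<open>k\<close>.\<close>

lemma neg_type_embedding:
  fixes D :: "'a \<Rightarrow> 'a \<Rightarrow> real"
  assumes "finite G" "p \<in> G"
    and sym: "\<And>i j. i \<in> G \<Longrightarrow> j \<in> G \<Longrightarrow> D i j = D j i"
    and diag: "\<And>i. i \<in> G \<Longrightarrow> D i i = 0"
    and neg: "\<And>x. sum x G = 0 \<Longrightarrow> qform G D x \<le> 0"
    and u: "sum u G = 0" "qform G D u = 0" "k \<in> G" "k \<noteq> p" "u k \<noteq> 0"
  shows "\<exists>f :: 'a \<Rightarrow> 'a \<Rightarrow> real. \<forall>i\<in>G. \<forall>j\<in>G. (\<Sum>c\<in>G - {p, k}. (f i c - f j c)\<^sup>2) = 2 * D i j"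
proof -
  define A where "A = G - {p}"
  have G: "G = insert p A" "p \<notin> A" "finite A" using assms by (auto simp: A_def)
  define g where "g i j = D i p + D j p - D i j" for i j
  have gp: "g i p = 0" "g p i = 0" if "i \<in> G" for i
    using that sym[of i p] diag[of p] assms(2) by (auto simp: g_def)
  \<comment> \<open>By \<open>gp\<close> the index \<open>p\<close> contributes nothing, and the
    terms with \<open>D i p\<close> or \<open>D j p\<close> carry the factor
    \<open>sum x G\<close>.\<close>
  have gA: "qform A g x = - qform G D x" if "sum x G = 0" for x
  proof -
    have "qform A g x = qform G g x"
      unfolding G(1) using G gp by (subst qform_insert) auto
    also have "\<dots> = (\<Sum>i\<in>G. \<Sum>j\<in>G. (D i p * x i) * x j + x i * (D j p * x j) - D i j * x i * x j)"
      by (simp add: qform_def g_def algebra_simps)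
    also have "\<dots> = (\<Sum>i\<in>G. D i p * x i) * sum x G + sum x G * (\<Sum>j\<in>G. D j p * x j) - qform G D x"
      by (simp only: qform_def sum_product sum.distrib sum_subtractf)
    finally show ?thesis using that by simp
  qed
  have "psd_on A g"
    unfolding psd_on_def
  proof (intro conjI ballI allI)
    fix i j assume "i \<in> A" "j \<in> A"
    then show "g i j = g j i" using sym[of i j] by (simp add: g_def A_def)
  next
    fix x :: "'a \<Rightarrow> real"
    \<comment> \<open>Any vector on \<open>A\<close> becomes sum-zero by a suitable value at
      \<open>p\<close>, which the form over \<open>A\<close> does not see.\<close>
    define y where "y = x(p := - sum x A)"
    have "sum y A = sum x A" using G(2) by (intro sum.cong) (auto simp: y_def)
    then have "sum y G = 0" unfolding G(1) using G by (simp add: y_def)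
    moreover have "qform A g x = qform A g y"
      using G(2) by (intro qform_cong) (auto simp: y_def)
    ultimately show "0 \<le> qform A g x" using gA[of y] neg[of y] by simp
  qed
  moreover have "qform A g u = 0" using gA u by simp
  ultimately obtain f where f: "\<And>i j. i \<in> A \<Longrightarrow> j \<in> A \<Longrightarrow> g i j = (\<Sum>c\<in>A - {k}. f i c * f j c)"
    using psd_singular_factorization[of A g u k] G(3) u by (auto simp: A_def)
  \<comment> \<open>The base point goes to the origin, in accordance with \<open>gp\<close>.\<close>
  define F where "F i c = (if i = p then 0 else f i c)" for i c
  have F: "g i j = (\<Sum>c\<in>A - {k}. F i c * F j c)" if "i \<in> G" "j \<in> G" for i j
    using that gp f by (cases "i = p"; cases "j = p") (auto simp: F_def A_def)
  have "(\<Sum>c\<in>A - {k}. (F i c - F j c)\<^sup>2) = 2 * D i j" if "i \<in> G" "j \<in> G" for i j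
  proof -
    have "(\<Sum>c\<in>A - {k}. (F i c - F j c)\<^sup>2) = g i i + g j j - 2 * g i j"
      using that by (simp add: F power2_eq_square sum.distrib sum_subtractf sum_distrib_left algebra_simps)
    \<comment> \<open>Here \<open>g i i = 2 * D i p\<close>, so the distances to \<open>p\<close>
      cancel.\<close>
    then show ?thesis using that diag by (simp add: g_def)
  qed
  moreover have "A - {k} = G - {p, k}" by (auto simp: A_def)
  ultimately show ?thesis by metis
qed

section \<open>Shifting the colours to squared distances\<close>

theorem theorem2:
  fixes G :: "'a set" and lam :: "'a \<Rightarrow> 'a \<Rightarrow> real"
  assumes "complete_edge_colored_graph G lam"
    and "\<exists>x\<in>G. \<exists>x'\<in>G. \<exists>y\<in>G. \<exists>y'\<in>G. x \<noteq> x' \<and> y \<noteq> y' \<and> lam x x' \<noteq> lam y y'"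
    and "CARD('n::finite) = card G - 2"
  shows "representable_in TYPE('n) G lam"
proof -
  have fin: "finite G" and diag: "\<And>x. x \<in> G \<Longrightarrow> lam x x = 0"
    and sym: "\<And>x y. x \<in> G \<Longrightarrow> y \<in> G \<Longrightarrow> lam x y = lam y x"
    using assms(1) by (auto simp: complete_edge_colored_graph_def)
  obtain p q where pq: "p \<in> G" "q \<in> G" "p \<noteq> q" using assms(2) by blast
  obtain u where u: "sum u G = 0" "(\<Sum>i\<in>G. (u i)\<^sup>2) = 1"
    and max: "\<And>x. sum x G = 0 \<Longrightarrow> qform G lam x \<le> qform G lam u * (\<Sum>i\<in>G. (x i)\<^sup>2)"
    using max_qform_sum_zero[OF fin pq] by metis
  define \<mu> where "\<mu> = qform G lam u"
  define D where "D i j = (if i = j then 0 else \<mu> + lam i j)" for i j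
  \<comment> \<open>The shift adds \<open>\<mu>\<close> times the all-ones form minus the identity
    form; the all-ones form is the square of \<open>sum x G\<close>.\<close>
  have qD: "qform G D x = qform G lam x - \<mu> * (\<Sum>i\<in>G. (x i)\<^sup>2)" if "sum x G = 0" for x
  proof -
    have "qform G D x = (\<Sum>i\<in>G. \<Sum>j\<in>G. lam i j * x i * x j + \<mu> * (x i * x j) - (if i = j then \<mu> * (x i)\<^sup>2 else 0))"
      unfolding qform_def D_def
      by (intro sum.cong refl) (auto simp: diag power2_eq_square algebra_simps)
    also have "\<dots> = qform G lam x + \<mu> * (sum x G * sum x G) - \<mu> * (\<Sum>i\<in>G. (x i)\<^sup>2)"
      unfolding sum_product
      using fin by (simp add: qform_def sum.distrib sum_subtractf sum_distrib_left)
    finally show ?thesis using that by simp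
  qed
  \<comment> \<open>A sum-zero vector supported at \<open>p\<close> alone is zero, which the unit
    norm of \<open>u\<close> excludes.\<close>
  obtain k where k: "k \<in> G" "k \<noteq> p" "u k \<noteq> 0"
  proof (rule ccontr)
    assume "\<not> thesis"
    with that have 0: "u i = 0" if "i \<in> G - {p}" for i using \<open>i \<in> G - {p}\<close> by blast
    then have "u p = 0" using u(1) sum.remove[OF fin pq(1), of u] by simp
    with 0 have "(\<Sum>i\<in>G. (u i)\<^sup>2) = 0" by (intro sum.neutral) auto
    with u(2) show False by simp
  qed
  have "\<exists>f :: 'a \<Rightarrow> 'a \<Rightarrow> real. \<forall>i\<in>G. \<forall>j\<in>G. (\<Sum>c\<in>G - {p, k}. (f i c - f j c)\<^sup>2) = 2 * D i j"
  proof (rule neg_type_embedding[OF fin pq(1) _ _ _ u(1) _ k])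
    show "D i j = D j i" if "i \<in> G" "j \<in> G" for i j
      using that sym by (simp add: D_def)
    show "qform G D x \<le> 0" if "sum x G = 0" for x
      using qD[OF that] max[OF that] by (simp add: \<mu>_def)
    show "qform G D u = 0"
      using qD[OF u(1)] u(2) by (simp add: \<mu>_def)
  qed (simp add: D_def)
  then obtain f where
    f: "\<And>i j. i \<in> G \<Longrightarrow> j \<in> G \<Longrightarrow> (\<Sum>c\<in>G - {p, k}. (f i c - f j c)\<^sup>2) = 2 * D i j"
    by blast
  \<comment> \<open>Losing the base point and the redundant coordinate \<open>k\<close> leaves
    exactly \<open>card G - 2\<close> axes.\<close>
  have "card (G - {p, k}) = CARD('n)"
    using assms(3) fin pq(1) k by (simp add: card_Diff_subset)
  then obtain b :: "'n \<Rightarrow> 'a" where b: "bij_betw b UNIV (G - {p, k})"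
    using finite_same_card_bij[of "UNIV :: 'n set" "G - {p, k}"] fin by auto
  define F :: "'a \<Rightarrow> real ^ 'n" where "F i = (\<chi> c. f i (b c))" for i
  have norm_F: "norm (F i - F j) = sqrt (2 * D i j)" if "i \<in> G" "j \<in> G" for i j
  proof -
    have "(\<Sum>c\<in>UNIV. (f i (b c) - f j (b c))\<^sup>2) = (\<Sum>c\<in>G - {p, k}. (f i c - f j c)\<^sup>2)"
      using b by (rule sum.reindex_bij_betw)
    then show ?thesis using f that by (simp add: F_def norm_vec_def L2_set_def)
  qed
  \<comment> \<open>\<open>sqrt\<close> is injective on the reals, and on distinct vertices
    \<open>D\<close> is \<open>lam\<close> plus the constant \<open>\<mu>\<close>.\<close>
  show ?thesis
    unfolding representable_in_def
    by (intro exI[of _ F]) (auto simp: norm_F D_def)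
qed

end
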